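(* Let $p\in[0,1)$, and consider the chance-constrained problem $$(\mathrm{CC})\qquad \min_{x\in\mathcal X} f(x)\quad\text{s.t.}\quad \mathbb P[g(x,\xi)\le 0]\ge p$$ and the bilevel problem $$(\mathrm{BL})\qquad \min_{x\in\mathcal X,\ \eta\in\mathbb R} f(x)\quad\text{s.t.}\quad \eta\le 0,\quad \eta\in S(x)=\operatorname{arg\,min}_{s\in\mathbb R} G(x,s),$$ where $G(x,s)=s+\frac{1}{1-p}\,\mathbb E[\max(g(x,\xi)-s,0)]$. Then (CC) is equivalent to (BL). More precisely, if $x^\star$ is an optimal solution of (CC), then $(x^\star, Q_p(g(x^\star,\xi)))$ is an optimal solution of (BL); and conversely, if $(x^\star, Q_p(g(x^\star,\xi)))$ is an optimal solution of (BL), then $x^\star$ is an optimal solution of (CC).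
   Context: $\mathcal X\subset\mathbb R^d$ is a closed set, $f:\mathbb R^d\to\mathbb R$ is convex, $g:\mathbb R^d\times\mathbb R^m\to\mathbb R$ is convex in its first argument, and $\xi$ is a random vector with values in $\mathbb R^m$ such that, for every $x$, $g(x,\xi)$ is an integrable real random variable. For a real random variable $X$ and $p\in[0,1)$, the $p$-quantile is $Q_p(X)=\inf\{t\in\mathbb R:\ \mathbb P[X\le t]\ge p\}$.
   Formalization: The implication from (CC) to (BL) is stated only for 0 < p < 1: at p = 0 the quantile Q_0 is −∞, so (x*, Q_0) is not a point of R^d × R, and (BL) may even be infeasible (e.g. g(x,ξ) Gaussian). *)

theory Defs
  imports "HOL-Probability.Probability"
begin

(* The infimum is taken in the extended reals: the set is all of the reals when p = 0, so the
   0-quantile is -\<infinity>. For 0 < p < 1 the quantile is finite. *)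
definition quantile :: "'w measure \<Rightarrow> ('w \<Rightarrow> real) \<Rightarrow> real \<Rightarrow> ereal" where
  "quantile M X p = Inf (ereal ` {t. \<P>(w in M. X w \<le> t) \<ge> p})"

definition lower_objective ::
  "'w measure \<Rightarrow> ('w \<Rightarrow> 'm) \<Rightarrow> ('d \<Rightarrow> 'm \<Rightarrow> real) \<Rightarrow> real \<Rightarrow> 'd \<Rightarrow> real \<Rightarrow> real" where
  "lower_objective M \<xi> g p x s = s + 1 / (1 - p) * (\<integral>w. max (g x (\<xi> w) - s) 0 \<partial>M)"

definition lower_solutions ::
  "'w measure \<Rightarrow> ('w \<Rightarrow> 'm) \<Rightarrow> ('d \<Rightarrow> 'm \<Rightarrow> real) \<Rightarrow> real \<Rightarrow> 'd \<Rightarrow> real set" where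
  "lower_solutions M \<xi> g p x = {s. is_arg_min (lower_objective M \<xi> g p x) (\<lambda>_. True) s}"

definition CC_optimal ::
  "'w measure \<Rightarrow> ('w \<Rightarrow> 'm) \<Rightarrow> 'd set \<Rightarrow> ('d \<Rightarrow> real) \<Rightarrow> ('d \<Rightarrow> 'm \<Rightarrow> real) \<Rightarrow> real \<Rightarrow> 'd \<Rightarrow> bool" where
  "CC_optimal M \<xi> X f g p =
     is_arg_min f (\<lambda>x. x \<in> X \<and> \<P>(w in M. g x (\<xi> w) \<le> 0) \<ge> p)"

definition BL_optimal ::
  "'w measure \<Rightarrow> ('w \<Rightarrow> 'm) \<Rightarrow> 'd set \<Rightarrow> ('d \<Rightarrow> real) \<Rightarrow> ('d \<Rightarrow> 'm \<Rightarrow> real) \<Rightarrow> real \<Rightarrow> 'd \<times> real \<Rightarrow> bool" where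
  "BL_optimal M \<xi> X f g p =
     is_arg_min (\<lambda>(x, \<eta>). f x) (\<lambda>(x, \<eta>). x \<in> X \<and> \<eta> \<le> 0 \<and> \<eta> \<in> lower_solutions M \<xi> g p x)"

end

theory Submission imports Defs begin

text \<open>
  For an integrable random variable \<open>Y\<close>, the one-sided derivatives of
  \<open>G s = s + E (max (Y - s) 0) / (1 - p)\<close> at \<open>s\<close> are
  \<open>1 - P (Y \<ge> s) / (1 - p)\<close> and \<open>1 - P (Y > s) / (1 - p)\<close>, so that \<open>s\<close> minimizes the convex
  function \<open>G\<close> if and only if \<open>P (Y < s) \<le> p \<le> P (Y \<le> s)\<close>. Hence the \<open>p\<close>-quantile is a minimizer,
  and every minimizer \<open>\<eta> \<le> 0\<close> witnesses \<open>P (Y \<le> 0) \<ge> p\<close>.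
\<close>

lemma (in prob_space) cdf_distr_eq_prob:
  assumes "random_variable borel Y"
  shows "cdf (distr M borel Y) t = \<P>(w in M. Y w \<le> t)"
  using assms by (auto simp: cdf_def measure_distr intro!: arg_cong[where f = prob])

text \<open>The limits 0 and 1 of the cdf make the set of admissible levels bounded below and
  nonempty, as \<open>0 < p\<close> and \<open>p < 1\<close>. Right continuity puts its infimum in
  the set, so monotonicity makes the set exactly the ray from \<open>q\<close> upwards.\<close>

lemma (in prob_space) obtain_quantile:
  fixes Y :: "'a \<Rightarrow> real"
  assumes Y: "random_variable borel Y" and p: "0 < p" "p < 1"
  obtains q where "ereal q = quantile M Y p" "\<And>t. p \<le> \<P>(w in M. Y w \<le> t) \<longleftrightarrow> q \<le> t"
proof -
  interpret D: real_distribution "distr M borel Y"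
    using Y by (rule real_distribution_distr)
  let ?F = "cdf (distr M borel Y)"
  define T where "T = {t. p \<le> ?F t}"
  have T_ne: "T \<noteq> {}"
  proof -
    have "\<forall>\<^sub>F t in at_top. p < ?F t"
      using D.cdf_lim_at_top_prob p(2) by (rule order_tendstoD)
    then obtain t where "p < ?F t" by (auto simp: eventually_at_top_linorder)
    then show ?thesis by (auto simp: T_def intro: less_imp_le)
  qed
  have T_bdd: "bdd_below T"
  proof -
    have "\<forall>\<^sub>F t in at_bot. ?F t < p"
      using D.cdf_lim_at_bot p(1) by (rule order_tendstoD)
    then obtain b where "\<And>t. t \<le> b \<Longrightarrow> ?F t < p" by (auto simp: eventually_at_bot_linorder)
    then show ?thesis by (intro bdd_belowI[of _ b]) (metis T_def linear mem_Collect_eq not_le)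
  qed
  have above: "p \<le> ?F t" if t: "Inf T < t" for t
  proof -
    obtain u where "u \<in> T" "u < t"
      using cInf_lessD[OF T_ne t] by blast
    then show ?thesis
      using D.cdf_nondecreasing[of u t] by (simp add: T_def)
  qed
  have "(?F \<longlongrightarrow> ?F (Inf T)) (at_right (Inf T))"
    using D.cdf_is_right_cont[of "Inf T"] by (simp add: continuous_within)
  then have at_Inf: "p \<le> ?F (Inf T)"
    by (rule tendsto_lowerbound) (auto intro!: eventually_at_rightI[of _ "Inf T + 1"] above)
  have "p \<le> ?F t \<longleftrightarrow> Inf T \<le> t" for t
    using at_Inf D.cdf_nondecreasing[of "Inf T" t] T_bdd
    by (auto simp: T_def intro: cInf_lower)
  moreover have "ereal (Inf T) = quantile M Y p"
    using ereal_Inf'[OF T_bdd T_ne] by (simp add: quantile_def T_def cdf_distr_eq_prob[OF Y])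
  ultimately show thesis
    using that by (simp add: cdf_distr_eq_prob[OF Y])
qed

text \<open>The probability of \<open>Y w < q\<close> is the left limit of the cdf at
  \<open>q\<close>, and a bound on all values to the left survives the limit.\<close>

lemma (in prob_space) prob_less_le_of_prob_le_less:
  fixes Y :: "'a \<Rightarrow> real"
  assumes Y: "random_variable borel Y" and le: "\<And>t. t < q \<Longrightarrow> \<P>(w in M. Y w \<le> t) \<le> p"
  shows "\<P>(w in M. Y w < q) \<le> p"
proof -
  interpret D: real_distribution "distr M borel Y"
    using Y by (rule real_distribution_distr)
  have "measure (distr M borel Y) {..<q} \<le> p"
    by (rule tendsto_upperbound[OF D.cdf_at_left])
      (auto simp: cdf_distr_eq_prob[OF Y] intro!: le eventually_at_leftI[of "q - 1"])
  moreover have "measure (distr M borel Y) {..<q} = \<P>(w in M. Y w < q)"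
    using Y by (auto simp: measure_distr intro!: arg_cong[where f = prob])
  ultimately show ?thesis by simp
qed

text \<open>Integrating the pointwise bound replaces any differentiation of the expected excess:
  \<open>c\<close> is a signed increment of the level and \<open>A\<close> the event on which it
  counts.\<close>

lemma (in prob_space) expectation_max_diff_le:
  fixes Y :: "'a \<Rightarrow> real"
  assumes Y: "integrable M Y" and A: "A \<in> events"
    and le: "\<And>w. w \<in> space M \<Longrightarrow> max (Y w - a) 0 + c * indicator A w \<le> max (Y w - b) 0"
  shows "expectation (\<lambda>w. max (Y w - a) 0) + c * prob A \<le> expectation (\<lambda>w. max (Y w - b) 0)"
proof -
  have A': "integrable M (\<lambda>w. c * indicator A w)"
    using A by (intro integrable_mult_right integrable_real_indicator) (auto simp: emeasure_eq_measure)
  have max: "integrable M (\<lambda>w. max (Y w - s) 0)" for s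
    using Y by (intro integrable_max) auto
  have "expectation (\<lambda>w. max (Y w - a) 0) + c * prob A =
      expectation (\<lambda>w. max (Y w - a) 0 + c * indicator A w)"
    using A sets.sets_into_space[OF A] by (simp add: Bochner_Integration.integral_add[OF max A'] Int_absorb2)
  also have "\<dots> \<le> expectation (\<lambda>w. max (Y w - b) 0)"
    using max A' le by (intro integral_mono) auto
  finally show ?thesis .
qed

lemma (in prob_space) lower_solutionsI:
  assumes Y: "integrable M (\<lambda>w. g x (\<xi> w))" and p: "p < 1"
    and less: "\<P>(w in M. g x (\<xi> w) < q) \<le> p" and le: "p \<le> \<P>(w in M. g x (\<xi> w) \<le> q)"
  shows "q \<in> lower_solutions M \<xi> g p x"
proof -
  define Y where "Y w = g x (\<xi> w)" for w
  define E where "E s = expectation (\<lambda>w. max (Y w - s) 0)" for s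
  have int: "integrable M Y" using Y by (simp add: Y_def[abs_def])
  then have [measurable]: "random_variable borel Y" by simp
  \<comment> \<open>This is \<open>G q \<le> G s\<close> multiplied by \<open>1 - p\<close>.\<close>
  have *: "E q - E s \<le> (s - q) * (1 - p)" for s
  proof (cases "q \<le> s")
    case True
    \<comment> \<open>Raising the level from \<open>q\<close> to \<open>s\<close> costs at most
      \<open>s - q\<close> where \<open>Y w > q\<close> and nothing elsewhere, hence the negative
      coefficient.\<close>
    have "E q + - (s - q) * \<P>(w in M. \<not> Y w \<le> q) \<le> E s"
      unfolding E_def using True
      by (intro expectation_max_diff_le int) (auto simp: indicator_def max_def)
    moreover have "\<P>(w in M. \<not> Y w \<le> q) \<le> 1 - p"
      using le by (subst prob_neg) (auto simp: Y_def[symmetric])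
    ultimately show ?thesis
      using mult_left_mono[of "\<P>(w in M. \<not> Y w \<le> q)" "1 - p" "s - q"] True by (simp add: algebra_simps)
  next
    case False
    \<comment> \<open>Lowering the level from \<open>q\<close> to \<open>s\<close> gains exactly
      \<open>q - s\<close> where \<open>Y w \<ge> q\<close>, and never loses.\<close>
    have "E q + (q - s) * \<P>(w in M. \<not> Y w < q) \<le> E s"
      unfolding E_def using False
      by (intro expectation_max_diff_le int) (auto simp: indicator_def max_def)
    moreover have "1 - p \<le> \<P>(w in M. \<not> Y w < q)"
      using less by (subst prob_neg) (auto simp: Y_def[symmetric])
    ultimately show ?thesis
      using mult_left_mono[of "1 - p" "\<P>(w in M. \<not> Y w < q)" "q - s"] False
      by (simp add: algebra_simps)
  qed
  have "q + 1 / (1 - p) * E q \<le> s + 1 / (1 - p) * E s" for s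
  proof -
    have "(E q - E s) / (1 - p) \<le> s - q"
      using * p by (simp add: pos_divide_le_eq)
    then show ?thesis by (simp add: diff_divide_distrib)
  qed
  then show ?thesis
    by (simp add: lower_solutions_def is_arg_min_linorder lower_objective_def E_def Y_def)
qed

text \<open>Between \<open>s\<close> and \<open>t\<close> the expected excess falls by at least
  \<open>t - s\<close> times the probability of exceeding \<open>t\<close>, while minimality of
  \<open>s\<close> caps the fall at \<open>(t - s) * (1 - p)\<close>. Comparing with a single
  \<open>t\<close> gives no bound at \<open>s\<close> itself.\<close>

lemma (in prob_space) lower_solutionsD:
  assumes Y: "integrable M (\<lambda>w. g x (\<xi> w))" and p: "p < 1"
    and s: "s \<in> lower_solutions M \<xi> g p x" and t: "s < t"
  shows "p \<le> \<P>(w in M. g x (\<xi> w) \<le> t)"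
proof -
  define Y where "Y w = g x (\<xi> w)" for w
  define E where "E s = expectation (\<lambda>w. max (Y w - s) 0)" for s
  have int: "integrable M Y" using Y by (simp add: Y_def[abs_def])
  then have [measurable]: "random_variable borel Y" by simp
  have "E t + (t - s) * \<P>(w in M. \<not> Y w \<le> t) \<le> E s"
    unfolding E_def using t
    by (intro expectation_max_diff_le int) (auto simp: indicator_def max_def)
  also have "E s \<le> E t + (t - s) * (1 - p)"
  proof -
    have "s + 1 / (1 - p) * E s \<le> t + 1 / (1 - p) * E t"
      using s by (simp add: lower_solutions_def is_arg_min_linorder lower_objective_def E_def Y_def)
    then have "(E s - E t) / (1 - p) \<le> t - s"
      by (simp add: diff_divide_distrib)
    then show ?thesis
      using p by (simp add: pos_divide_le_eq)
  qed
  finally have "\<P>(w in M. \<not> Y w \<le> t) \<le> 1 - p"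
    using t by simp
  then show ?thesis
    by (subst (asm) prob_neg) (auto simp: Y_def[symmetric])
qed

text \<open>For \<open>p = 0\<close> the quantile is minus infinity, which no real
  \<open>\<eta>\<close> equals. So the first half is restricted to \<open>0 < p\<close>, whereas in
  the second half the existence of \<open>\<eta>\<close> enforces it.\<close>

theorem theorem3:
  fixes M :: "'w measure"
    and \<xi> :: "'w \<Rightarrow> real ^ 'm"
    and X :: "(real ^ 'd) set"
    and f :: "real ^ 'd \<Rightarrow> real"
    and g :: "real ^ 'd \<Rightarrow> real ^ 'm \<Rightarrow> real"
    and p :: real
  assumes "prob_space M"
    and "\<xi> \<in> borel_measurable M"
    and "closed X"
    and "convex_on UNIV f"
    and "\<And>y. convex_on UNIV (\<lambda>x. g x y)"
    and "\<And>x. integrable M (\<lambda>w. g x (\<xi> w))"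
    and "0 \<le> p" and "p < 1"
  shows "(\<forall>x. 0 < p \<longrightarrow> CC_optimal M \<xi> X f g p x \<longrightarrow>
            (\<exists>\<eta>. ereal \<eta> = quantile M (\<lambda>w. g x (\<xi> w)) p \<and> BL_optimal M \<xi> X f g p (x, \<eta>))) \<and>
         (\<forall>x. (\<exists>\<eta>. ereal \<eta> = quantile M (\<lambda>w. g x (\<xi> w)) p \<and> BL_optimal M \<xi> X f g p (x, \<eta>)) \<longrightarrow>
            CC_optimal M \<xi> X f g p x)"
proof -
  interpret prob_space M by fact
  have int: "integrable M (\<lambda>w. g x (\<xi> w))" for x by fact
  have rv: "random_variable borel (\<lambda>w. g x (\<xi> w))" for x
    using int by (rule borel_measurable_integrable)
  let ?C = "\<lambda>x. p \<le> \<P>(w in M. g x (\<xi> w) \<le> 0)"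
  have p_pos: "0 < p" if "ereal \<eta> = quantile M Y p" for \<eta> Y
  proof (rule ccontr)
    assume "\<not> 0 < p"
    then have "{t. p \<le> \<P>(w in M. Y w \<le> t)} = UNIV"
      by (auto intro: order_trans[OF _ measure_nonneg])
    then have "quantile M Y p \<le> ereal (\<eta> - 1)"
      unfolding quantile_def by (intro Inf_lower) blast
    then show False
      using that[symmetric] by simp
  qed
  have CC: "?C x" if "0 < p" "\<eta> \<le> 0" "\<eta> \<in> lower_solutions M \<xi> g p x" for x \<eta>
  proof -
    obtain q where q: "\<And>t. p \<le> \<P>(w in M. g x (\<xi> w) \<le> t) \<longleftrightarrow> q \<le> t"
      using obtain_quantile[OF rv \<open>0 < p\<close> \<open>p < 1\<close>] by blast
    \<comment> \<open>The quantile lies below every point to the right of \<open>\<eta>\<close>,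
      hence by density below \<open>\<eta>\<close>; this supplies the missing passage to the
      limit.\<close>
    have "q \<le> t" if "\<eta> < t" for t
      using lower_solutionsD[OF int \<open>p < 1\<close> \<open>\<eta> \<in> _\<close> that] q by blast
    then have "q \<le> \<eta>"
      by (rule dense_ge)
    with \<open>\<eta> \<le> 0\<close> show ?thesis by (simp add: q)
  qed
  have BL: "\<exists>\<eta>. ereal \<eta> = quantile M (\<lambda>w. g x (\<xi> w)) p \<and> \<eta> \<le> 0 \<and> \<eta> \<in> lower_solutions M \<xi> g p x"
    if "0 < p" "?C x" for x
  proof -
    obtain q where eq: "ereal q = quantile M (\<lambda>w. g x (\<xi> w)) p"
      and q: "\<And>t. p \<le> \<P>(w in M. g x (\<xi> w) \<le> t) \<longleftrightarrow> q \<le> t"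
      using obtain_quantile[OF rv \<open>0 < p\<close> \<open>p < 1\<close>] by blast
    have "\<P>(w in M. g x (\<xi> w) \<le> t) \<le> p" if "t < q" for t
      using q[of t] that by linarith
    then have "\<P>(w in M. g x (\<xi> w) < q) \<le> p"
      by (rule prob_less_le_of_prob_le_less[OF rv])
    then have "q \<in> lower_solutions M \<xi> g p x"
      using q by (intro lower_solutionsI[where g = g and x = x and \<xi> = \<xi>, OF int \<open>p < 1\<close>]) auto
    with eq q \<open>?C x\<close> show ?thesis by blast
  qed
  have CC_iff: "CC_optimal M \<xi> X f g p x \<longleftrightarrow> x \<in> X \<and> ?C x \<and> (\<forall>y. y \<in> X \<and> ?C y \<longrightarrow> f x \<le> f y)" for x
    unfolding CC_optimal_def is_arg_min_linorder by blast
  have BL_iff: "BL_optimal M \<xi> X f g p (x, \<eta>) \<longleftrightarrow>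
      x \<in> X \<and> \<eta> \<le> 0 \<and> \<eta> \<in> lower_solutions M \<xi> g p x \<and>
      (\<forall>y \<zeta>. y \<in> X \<and> \<zeta> \<le> 0 \<and> \<zeta> \<in> lower_solutions M \<xi> g p y \<longrightarrow> f x \<le> f y)" for x \<eta>
    unfolding BL_optimal_def is_arg_min_linorder split_paired_All prod.case by blast
  \<comment> \<open>By \<open>CC\<close> and \<open>BL\<close>, for \<open>0 < p\<close> both
    problems admit the same \<open>x\<close>, and the bilevel objective ignores
    \<open>\<eta>\<close>; so optimality transfers both ways.\<close>
  show ?thesis
  proof (intro conjI allI impI)
    fix x
    assume "0 < p" "CC_optimal M \<xi> X f g p x"
    then show "\<exists>\<eta>. ereal \<eta> = quantile M (\<lambda>w. g x (\<xi> w)) p \<and> BL_optimal M \<xi> X f g p (x, \<eta>)"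
      unfolding CC_iff BL_iff using BL[of x] CC by blast
  next
    fix x
    assume "\<exists>\<eta>. ereal \<eta> = quantile M (\<lambda>w. g x (\<xi> w)) p \<and> BL_optimal M \<xi> X f g p (x, \<eta>)"
    then show "CC_optimal M \<xi> X f g p x"
      unfolding CC_iff BL_iff using BL CC p_pos by blast
  qed
qed

end
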